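(* There is an absolute constant $c>0$ such that, for every integer $n\ge 1$, every set $A\subseteq[n]$ with $|A|\ge n/2$ contains an ascending wave of length at least $c(\log n)^2$.
   Context: Here $[n]=\{1,\ldots,n\}$ and $\log$ is the natural logarithm. A strictly increasing sequence of integers $x_0<x_1<\cdots<x_m$ is an ascending wave if its consecutive differences are nondecreasing, i.e. $x_t-x_{t-1}\le x_{t+1}-x_t$ for all $1\le t<m$. Sequences of one or two terms are ascending waves by convention. The length of a finite sequence is its number of terms. A set $A$ contains an ascending wave if all terms of the wave belong to $A$. *)

theory Defs
  imports Complex_Main
begin

text \<open>
  A sequence \<open>x\<^sub>0 < \<dots> < x\<^sub>m\<close> is the list of its \<open>m + 1\<close> terms, so its number of terms is
  \<^const>\<open>length\<close>. As in the indexing from \<open>0\<close> to \<open>m\<close>, a sequence has at least one term.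
\<close>

definition ascending_wave :: "int list \<Rightarrow> bool" where
  "ascending_wave xs \<longleftrightarrow>
     xs \<noteq> [] \<and> sorted_wrt (<) xs \<and>
     (\<forall>t. 1 \<le> t \<and> t < length xs - 1 \<longrightarrow> xs ! t - xs ! (t - 1) \<le> xs ! (t + 1) - xs ! t)"

end

theory Submission
  imports Defs
begin

text \<open>
  The gaps of a wave are followed through the scales \<open>d = 4 ^ j\<close>. There are about \<open>ln n\<close> of them,
  and at a constant proportion of them the wave can pick up about \<open>ln n\<close> terms with gaps of
  size comparable to \<open>d\<close>.

  At one scale, the terms are obtained by rounding planned positions \<open>q\<close> up to the next
  element \<open>q + h q\<close> of \<open>A\<close>. Rounding perturbs the gaps, and this is repaired by increasing the
  planned gap by \<open>2 * h q\<close> at each visited position \<open>q\<close>; then the actual gaps never decrease. The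
  scale is left only once \<open>h\<close>, summed along the orbit, has grown to the order of \<open>d\<close>. The set
  \<open>A\<close> may be arranged so that a given orbit falls into many holes, but not so that all orbits do:
  the map from (position, gap) to the next (position, gap) is injective on \<open>\<int> \<times> \<int>\<close>, so the
  \<open>d\<^sup>2\<close> orbits that start in a suitable \<open>d \<times> d\<close> box visit every pair at most once altogether.
  Hence one of them sees little of \<open>h\<close> as soon as the sum of \<open>h\<close> over the window that the orbits
  can reach is at most \<open>d\<^sup>2 / 4\<close> (\<open>exists_light_orbit\<close>, \<open>extend_wave\<close>). Moreover the box may be
  placed just after an arbitrary point, so the pieces for successive scales can be joined
  (\<open>wave_through_cheap_scales\<close>).

  It remains to find a point of \<open>A\<close> whose windows are cheap at most scales. The window for \<open>m\<close>
  terms has length of order \<open>m * d\<close>. A hole of length \<open>s\<close> adds about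
  \<open>(min s d)\<^sup>2\<close> to the cost, measured in units of \<open>d\<^sup>2\<close>, and lies in the windows of \<open>O(m * d)\<close> points; the sum over
  \<open>d\<close> is a pair of geometric series and is \<open>O(m * s)\<close>. The holes have total length \<open>O(n)\<close> and
  \<open>A\<close> has at least \<open>n / 2\<close> points, so some point of \<open>A\<close> has total relative cost \<open>O(m)\<close> and thus
  \<open>O(m)\<close> expensive scales (\<open>exists_cheap_start\<close>). With \<open>m\<close> a small multiple of the number of
  scales, half of the scales are cheap and each of them yields \<open>m\<close> terms.
\<close>

section \<open>Waves with a bounded last difference\<close>

text \<open>
  Whether a wave can be prolonged depends only on its last term and its last gap. The number \<open>g\<close>
  is an upper bound for that gap, so that a wave can be carried unchanged to a larger scale.
\<close>

definition wave_reaches :: "int set \<Rightarrow> nat \<Rightarrow> int \<Rightarrow> int \<Rightarrow> bool" where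
  "wave_reaches A l e g \<longleftrightarrow>
     (\<exists>xs. ascending_wave xs \<and> set xs \<subseteq> A \<and> length xs = l \<and> last xs = e \<and>
       (2 \<le> l \<longrightarrow> xs ! (l - 1) - xs ! (l - 2) \<le> g))"

lemma wave_reaches_singleton: "e \<in> A \<Longrightarrow> wave_reaches A 1 e g"
  unfolding wave_reaches_def ascending_wave_def by (intro exI[of _ "[e]"]) auto

lemma wave_reaches_mono: "wave_reaches A l e g \<Longrightarrow> g \<le> g' \<Longrightarrow> wave_reaches A l e g'"
  unfolding wave_reaches_def by fastforce

lemma wave_reaches_snoc:
  assumes "wave_reaches A l e g" "f \<in> A" "e < f" "g \<le> f - e"
  shows "wave_reaches A (Suc l) f (f - e)"
proof -
  from assms(1) obtain xs where xs: "ascending_wave xs" "set xs \<subseteq> A" "length xs = l" "last xs = e"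
    "2 \<le> l \<longrightarrow> xs ! (l - 1) - xs ! (l - 2) \<le> g"
    unfolding wave_reaches_def by blast
  have ne: "xs \<noteq> []" and srt: "sorted_wrt (<) xs" and asc:
    "\<And>t. 1 \<le> t \<Longrightarrow> t < l - 1 \<Longrightarrow> xs ! t - xs ! (t - 1) \<le> xs ! (t + 1) - xs ! t"
    using xs(1,3) unfolding ascending_wave_def by auto
  have l: "l \<ge> 1" using ne xs(3) by (cases xs) auto
  have e: "xs ! (l - 1) = e" using ne xs(3,4) by (simp add: last_conv_nth)
  have below: "x < f" if x: "x \<in> set xs" for x
  proof -
    obtain i where i: "i < l" "x = xs ! i" using x xs(3) by (auto simp: in_set_conv_nth)
    have "x \<le> e"
    proof (cases "i = l - 1")
      case False
      then have "xs ! i < xs ! (l - 1)" using srt i xs(3) by (simp add: sorted_wrt_nth_less)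
      then show ?thesis using i e by simp
    qed (use i e in simp)
    then show ?thesis using assms(3) by simp
  qed
  have "ascending_wave (xs @ [f])"
    unfolding ascending_wave_def
  proof (intro conjI allI impI)
    show "sorted_wrt (<) (xs @ [f])" using srt below by (simp add: sorted_wrt_append)
  next
    fix t assume "1 \<le> t \<and> t < length (xs @ [f]) - 1"
    then have t: "1 \<le> t" "t < l" using xs(3) by auto
    show "(xs @ [f]) ! t - (xs @ [f]) ! (t - 1) \<le> (xs @ [f]) ! (t + 1) - (xs @ [f]) ! t"
    proof (cases "t = l - 1")
      case True
      then have "2 \<le> l" "t - 1 = l - 2" "t + 1 = l" using t by auto
      then have "xs ! t - xs ! (t - 1) \<le> f - e" using xs(5) assms(4) True by auto
      then show ?thesis using t xs(3) \<open>t + 1 = l\<close> True e by (simp add: nth_append)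
    next
      case False
      then have "t < l - 1" using t by simp
      then have "t - 1 < l" "t + 1 < l" by auto
      then show ?thesis using asc[OF t(1) \<open>t < l - 1\<close>] xs(3) t by (simp add: nth_append)
    qed
  qed simp
  moreover have "(xs @ [f]) ! (Suc l - 1) - (xs @ [f]) ! (Suc l - 2) \<le> f - e"
    using l e xs(3) by (simp add: nth_append)
  ultimately show ?thesis
    unfolding wave_reaches_def using xs assms(2) by (intro exI[of _ "xs @ [f]"]) auto
qed

section \<open>An injective dynamical system on positions and gaps\<close>

text \<open>
  A state consists of a position and the gap with which it was reached. This is a discrete
  relative of the standard map: the gap is kicked by an amount that depends on the position, and
  the position then moves by the new gap. Two shears are composed, whence the injectivity.
\<close>

definition kick :: "(int \<Rightarrow> int) \<Rightarrow> int \<times> int \<Rightarrow> int \<times> int" where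
  "kick h s = (fst s + (snd s + 2 * h (fst s)), snd s + 2 * h (fst s))"

lemma fst_kick: "fst (kick h s) = fst s + (snd s + 2 * h (fst s))"
  and snd_kick: "snd (kick h s) = snd s + 2 * h (fst s)"
  by (simp_all add: kick_def)

lemma inj_kick: "inj (kick h)"
proof (rule injI)
  fix s t assume eq: "kick h s = kick h t"
  then have "fst s = fst t" unfolding kick_def by simp
  then show "s = t" using eq unfolding kick_def by (simp add: prod_eq_iff)
qed

lemma kick_orbit_bounds:
  assumes h: "\<And>p. h p \<ge> 0" and D: "snd s \<ge> 0"
  shows "snd ((kick h ^^ i) s) = snd s + 2 * (\<Sum>l<i. h (fst ((kick h ^^ l) s)))"
    and "fst s + int i * snd s \<le> fst ((kick h ^^ i) s)"
    and "fst ((kick h ^^ i) s) \<le>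
           fst s + int i * (snd s + 2 * (\<Sum>l<i. h (fst ((kick h ^^ l) s))))"
proof (induction i)
  case (Suc i)
  let ?S = "\<lambda>i. \<Sum>l<i. h (fst ((kick h ^^ l) s))"
  let ?q = "(kick h ^^ i) s"
  have S0: "?S (Suc i) \<ge> ?S i" "?S i \<ge> 0" using h by (auto simp: sum_nonneg)
  {
    case 1 show ?case using Suc.IH(1) by (simp add: fst_kick snd_kick)
  next
    case 2
    have "fst ((kick h ^^ Suc i) s) = fst ?q + (snd s + 2 * ?S (Suc i))"
      using Suc.IH(1) by (simp add: fst_kick snd_kick)
    then show ?case using Suc.IH(2) S0 by (simp add: algebra_simps)
  next
    case 3
    have "fst ((kick h ^^ Suc i) s) = fst ?q + (snd s + 2 * ?S (Suc i))"
      using Suc.IH(1) by (simp add: fst_kick snd_kick)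
    also have "\<dots> \<le> fst s + int i * (snd s + 2 * ?S i) + (snd s + 2 * ?S (Suc i))"
      using Suc.IH(3) by simp
    also have "\<dots> \<le> fst s + int i * (snd s + 2 * ?S (Suc i)) + (snd s + 2 * ?S (Suc i))"
      using S0 by (simp add: mult_left_mono)
    finally show ?case by (simp add: algebra_simps)
  }
qed simp_all

text \<open>
  Suppose that every start in the \<open>d \<times> d\<close> box picks up more than \<open>d / 2\<close> of \<open>h\<close>. Until this
  happens the gap stays below \<open>3 * d + d\<close>, so that the orbit is confined to the product \<open>R\<close> of
  the window with \<open>{2 * d..<4 * d}\<close>. No state of \<open>R\<close> is visited twice, since the map is
  injective and an orbit that has left the box has moved beyond it: one step is at least \<open>2 * d\<close>
  long and the box is only \<open>d\<close> wide. Counting \<open>h\<close> over all visits gives more than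
  \<open>d\<^sup>2 * (d / 2)\<close>, counting it over \<open>R\<close> gives \<open>2 * d\<close> times its sum over the window.
\<close>

lemma exists_light_orbit:
  fixes h :: "int \<Rightarrow> int" and d e :: int and m :: nat
  assumes h: "\<And>p. h p \<ge> 0" and d: "d \<ge> 1"
    and light: "4 * (\<Sum>p\<in>{e..e + 4 * int m * d}. h p) \<le> d\<^sup>2"
  shows "\<exists>s. fst s \<in> {e + d..<e + 2 * d} \<and> snd s \<in> {2 * d..<3 * d} \<and>
             2 * (\<Sum>i<m. h (fst ((kick h ^^ i) s))) \<le> d"
proof (rule ccontr)
  define B where "B = {e + d..<e + 2 * d} \<times> {2 * d..<3 * d}"
  define R where "R = {e..e + 4 * int m * d} \<times> {2 * d..<4 * d}"
  define orb where "orb = (\<lambda>(s, i). (kick h ^^ i) s)"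
  define S where "S = (\<lambda>s i. \<Sum>l<i. h (fst ((kick h ^^ l) s)))"
  define I where "I = (\<lambda>s. {i. i < m \<and> 2 * S s i \<le> d})"
  assume "\<not> ?thesis"
  then have heavy: "2 * S s m > d" if "s \<in> B" for s
    using that unfolding B_def S_def by (metis linorder_not_le mem_Times_iff)
  have Smono: "S s i \<le> S s j" if "i \<le> j" for s i j
    unfolding S_def using that h by (intro sum_mono2) auto
  have S0: "S s i \<ge> 0" for s i unfolding S_def by (simp add: h sum_nonneg)
  have snd_orb: "snd ((kick h ^^ i) s) = snd s + 2 * S s i" if "s \<in> B" for s i
    unfolding S_def using that d by (intro kick_orbit_bounds(1)) (auto simp: h B_def)
  have fst_lo: "fst s + int i * snd s \<le> fst ((kick h ^^ i) s)" if "s \<in> B" for s i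
    using that d by (intro kick_orbit_bounds(2)) (auto simp: h B_def)
  have fst_hi: "fst ((kick h ^^ i) s) \<le> fst s + int i * (snd s + 2 * S s i)" if "s \<in> B" for s i
    unfolding S_def using that d by (intro kick_orbit_bounds(3)) (auto simp: h B_def)

  \<comment> \<open>\<open>I s\<close> is the set of times up to and including the first visit at which the sum of \<open>h\<close>
    exceeds \<open>d / 2\<close>; up to then the orbit is under control.\<close>
  have in_R: "orb (s, i) \<in> R" if s: "s \<in> B" and i: "i \<in> I s" for s i
  proof -
    have sb: "e + d \<le> fst s" "fst s < e + 2 * d" "2 * d \<le> snd s" "snd s < 3 * d"
      using s by (auto simp: B_def)
    have im: "int i + 1 \<le> int m" "2 * S s i \<le> d" using i by (auto simp: I_def)
    have D: "snd s + 2 * S s i < 4 * d" using sb im by linarith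
    have "fst ((kick h ^^ i) s) \<le> fst s + int i * (4 * d)"
      using fst_hi[OF s, of i] D mult_left_mono[of "snd s + 2 * S s i" "4 * d" "int i"] by simp
    also have "\<dots> \<le> e + (int i + 1) * (4 * d)" using sb d by (simp add: algebra_simps)
    also have "\<dots> \<le> e + int m * (4 * d)" using im d by (simp add: mult_right_mono)
    finally have up: "fst ((kick h ^^ i) s) \<le> e + 4 * int m * d" by (simp add: algebra_simps)
    have "0 \<le> int i * snd s" using sb d by simp
    then have "e \<le> fst ((kick h ^^ i) s)" using fst_lo[OF s, of i] sb d by linarith
    then show ?thesis using up D sb snd_orb[OF s, of i] S0[of s i]
      unfolding R_def orb_def by (auto simp: mem_Times_iff)
  qed
  have no_return: "(kick h ^^ k) s \<notin> B" if "s \<in> B" "k > 0" for s k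
  proof
    assume "(kick h ^^ k) s \<in> B"
    then have "fst ((kick h ^^ k) s) < e + 2 * d" by (auto simp: B_def)
    moreover have "2 * d \<le> snd s" "e + d \<le> fst s" using that(1) by (auto simp: B_def)
    moreover from this have "1 * snd s \<le> int k * snd s"
      using that(2) d by (intro mult_right_mono) auto
    ultimately show False using fst_lo[OF that(1), of k] d by linarith
  qed
  have inj_aux: "i = j \<and> s = t" if "s \<in> B" "t \<in> B" "i \<le> j"
    and eq: "(kick h ^^ i) s = (kick h ^^ j) t" for s t i j
  proof -
    have "(kick h ^^ j) t = (kick h ^^ i) ((kick h ^^ (j - i)) t)"
      using that(3) by (metis comp_apply funpow_add le_add_diff_inverse)
    moreover have "inj (kick h ^^ i)" by (rule inj_fn[OF inj_kick])
    ultimately have "s = (kick h ^^ (j - i)) t" using eq by (simp add: inj_eq)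
    then show ?thesis using no_return[OF that(2), of "j - i"] that by (cases "j - i") auto
  qed
  have inj: "inj_on orb (Sigma B I)"
  proof (rule inj_onI)
    fix y z assume "y \<in> Sigma B I" "z \<in> Sigma B I" and eq: "orb y = orb z"
    then obtain s i t j where *: "s \<in> B" "t \<in> B" and yz: "y = (s, i)" "z = (t, j)" by blast
    have eq': "(kick h ^^ i) s = (kick h ^^ j) t" using eq by (simp add: orb_def yz)
    show "y = z"
    proof (cases "i \<le> j")
      case True
      then show ?thesis using inj_aux[OF * True eq'] by (simp add: yz)
    next
      case False
      then show ?thesis using inj_aux[OF *(2,1) _ eq'[symmetric]] by (simp add: yz)
    qed
  qed
  have big: "d + 1 \<le> 2 * (\<Sum>i\<in>I s. h (fst (orb (s, i))))" if s: "s \<in> B" for s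
  proof -
    define k where "k = (LEAST k. 2 * S s k > d)"
    have k: "2 * S s k > d" unfolding k_def using heavy[OF s] by (rule LeastI)
    have "k \<le> m" unfolding k_def using heavy[OF s] by (rule Least_le)
    then have "{..<k} \<subseteq> I s" unfolding I_def k_def by (auto dest: not_less_Least)
    then have "S s k \<le> (\<Sum>i\<in>I s. h (fst (orb (s, i))))"
      unfolding S_def orb_def by (auto intro!: sum_mono2 simp: h I_def)
    then show ?thesis using k by simp
  qed
  have finB: "finite B" "card B = nat d * nat d" unfolding B_def by auto
  have finI: "finite (I s)" for s unfolding I_def by simp
  have "d * d * (d + 1) = (\<Sum>s\<in>B. d + 1)" using finB d by simp
  also have "\<dots> \<le> (\<Sum>s\<in>B. 2 * (\<Sum>i\<in>I s. h (fst (orb (s, i)))))" by (intro sum_mono big)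
  also have "\<dots> = 2 * (\<Sum>s\<in>B. \<Sum>i\<in>I s. h (fst (orb (s, i))))" by (simp add: sum_distrib_left)
  also have "(\<Sum>s\<in>B. \<Sum>i\<in>I s. h (fst (orb (s, i)))) = (\<Sum>z\<in>Sigma B I. h (fst (orb z)))"
    using finB finI by (subst sum.Sigma) (auto intro!: sum.cong)
  also have "\<dots> = (\<Sum>w\<in>orb ` Sigma B I. h (fst w))" by (simp add: sum.reindex[OF inj])
  also have "\<dots> \<le> (\<Sum>w\<in>R. h (fst w))"
  proof (intro sum_mono2)
    show "orb ` Sigma B I \<subseteq> R" using in_R by blast
  qed (auto simp: h R_def)
  also have "\<dots> = 2 * d * (\<Sum>p\<in>{e..e + 4 * int m * d}. h p)"
  proof -
    have "(\<Sum>w\<in>R. h (fst w)) = (\<Sum>p\<in>{e..e + 4 * int m * d}. \<Sum>D\<in>{2 * d..<4 * d}. h p)"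
      unfolding R_def by (simp only: sum.cartesian_product case_prod_unfold)
    then show ?thesis using d by (simp add: sum_distrib_left)
  qed
  finally have "d * (d * (d + 1)) \<le> d * (4 * (\<Sum>p\<in>{e..e + 4 * int m * d}. h p))"
    by (simp add: algebra_simps)
  then have "d * (d + 1) \<le> d\<^sup>2" using light d by simp
  then show False using d by (simp add: power2_eq_square algebra_simps)
qed

text \<open>
  With \<open>a i = q i + h (q i)\<close> the gap \<open>a (i + 1) - a i\<close> is \<open>D i + h (q i) + h (q (i + 1))\<close>: the
  kick \<open>2 * h (q i)\<close> has turned the loss \<open>- h (q i)\<close> from rounding into a gain. Hence two
  consecutive gaps differ by \<open>h (q i) + h (q (i + 2)) \<ge> 0\<close>. All gaps lie between \<open>d\<close> and \<open>4 * d\<close>, which is why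
  the scales are powers of \<open>4\<close>.
\<close>

lemma extend_wave:
  fixes h :: "int \<Rightarrow> int" and d e :: int and m :: nat
  assumes h: "\<And>p. h p \<ge> 0" and d: "d \<ge> 1" and m: "m \<ge> 1"
    and light: "4 * (\<Sum>p\<in>{e..e + 4 * int m * d}. h p) \<le> d\<^sup>2"
    and mem: "\<And>p. p \<in> {e..e + 4 * int m * d} \<Longrightarrow> p + h p \<in> A"
    and wave: "wave_reaches A l e d"
  shows "\<exists>e'. wave_reaches A (l + m) e' (4 * d) \<and> e \<le> e' \<and> e' \<le> e + (4 * int m + 1) * d"
proof -
  obtain s where s: "fst s \<in> {e + d..<e + 2 * d}" "snd s \<in> {2 * d..<3 * d}"
    and small: "2 * (\<Sum>i<m. h (fst ((kick h ^^ i) s))) \<le> d"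
    using exists_light_orbit[OF h d light] by blast
  define q where "q = (\<lambda>i. fst ((kick h ^^ i) s))"
  define D where "D = (\<lambda>i. snd ((kick h ^^ i) s))"
  define a where "a = (\<lambda>i. q i + h (q i))"
  have q0: "e + d \<le> q 0" "q 0 < e + 2 * d" and D0: "2 * d \<le> D 0" "D 0 < 3 * d"
    using s by (auto simp: q_def D_def)
  have D: "D (Suc i) = D i + 2 * h (q i)" and q: "q (Suc i) = q i + D (Suc i)" for i
    by (simp_all add: q_def D_def fst_kick snd_kick)
  have DS: "D i = D 0 + 2 * (\<Sum>l<i. h (q l))" for i
    by (induction i) (simp_all add: D)
  have part: "2 * (\<Sum>l<i. h (q l)) \<le> d" if "i \<le> m" for i
  proof -
    have "(\<Sum>l<i. h (q l)) \<le> (\<Sum>l<m. h (q l))" using that h by (intro sum_mono2) auto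
    then show ?thesis using small by (simp add: q_def)
  qed
  have Dlo: "2 * d \<le> D i" for i using D0 DS[of i] h by (simp add: sum_nonneg add_increasing2)
  have Dhi: "D i < 4 * d" if "i \<le> m" for i using DS[of i] part[OF that] D0 by linarith
  have qlo: "e + d \<le> q i" for i
  proof (induction i)
    case (Suc i)
    then show ?case using q[of i] Dlo[of "Suc i"] d by linarith
  qed (use q0 in simp)
  have qhi: "q i < e + 2 * d + int i * (4 * d)" if "i < m" for i
    using that
  proof (induction i)
    case (Suc i)
    then show ?case using q[of i] Dhi[of "Suc i"] by (simp add: algebra_simps)
  qed (use q0 in simp)
  have qhi': "q i \<le> e + 4 * int m * d" if "i < m" for i
  proof -
    have "(int i + 1) * (4 * d) \<le> int m * (4 * d)" using that d by (intro mult_right_mono) auto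
    then show ?thesis using qhi[OF that] d by (simp add: algebra_simps)
  qed
  have aA: "a i \<in> A" if "i < m" for i
    unfolding a_def using qlo[of i] qhi'[OF that] d by (intro mem) auto
  have hd: "h (q i) \<le> d" if "i < m" for i
  proof -
    have "h (q i) \<le> (\<Sum>l<m. h (q l))" using that h by (intro member_le_sum) auto
    then show ?thesis using small h[of "q i"] by (simp add: q_def)
  qed
  define g where "g = (\<lambda>i. case i of 0 \<Rightarrow> a 0 - e | Suc k \<Rightarrow> a (Suc k) - a k)"
  have g0: "d \<le> g 0" using q0 h[of "q 0"] by (simp add: g_def a_def)
  have gS: "g (Suc i) = D i + h (q i) + h (q (Suc i))" for i
    by (simp add: g_def a_def q D)
  have gmono: "g i \<le> g (Suc i)" for i
  proof (cases i)
    case 0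
    then show ?thesis using q0 D0 h[of "q (Suc 0)"] by (simp add: gS) (simp add: g_def a_def)
  next
    case (Suc k)
    then show ?thesis using h[of "q k"] h[of "q (Suc (Suc k))"] by (simp add: gS D)
  qed
  have gpos: "d \<le> g i" for i by (induction i) (use g0 gmono in \<open>auto intro: order_trans\<close>)
  have reach: "wave_reaches A (l + Suc i) (a i) (g i)" if "i < m" for i
    using that
  proof (induction i)
    case 0
    have "wave_reaches A (Suc l) (a 0) (a 0 - e)"
      using g0 d 0 by (intro wave_reaches_snoc[OF wave aA]) (auto simp: g_def)
    then show ?case by (simp add: g_def)
  next
    case (Suc i)
    have "wave_reaches A (Suc (l + Suc i)) (a (Suc i)) (a (Suc i) - a i)"
      using Suc gmono[of i] gpos[of "Suc i"] d
      by (intro wave_reaches_snoc[OF _ aA]) (auto simp: g_def)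
    then show ?case by (simp add: g_def)
  qed
  \<comment> \<open>For \<open>m \<ge> 2\<close> the last gap involves each value of \<open>h\<close> along the orbit at most twice, so it is at most
    \<open>D 0 + d\<close>.\<close>
  obtain k where k: "m = Suc k" using m by (cases m) auto
  have "g k \<le> 4 * d"
  proof (cases k)
    case 0
    then show ?thesis using q0 hd[of 0] k d by (simp add: g_def a_def)
  next
    case (Suc i)
    have "2 * (\<Sum>l<m. h (q l)) \<le> d" using part by blast
    moreover have "(\<Sum>l<m. h (q l)) = (\<Sum>l<i. h (q l)) + h (q i) + h (q (Suc i))"
      using k Suc by simp
    ultimately show ?thesis using DS[of i] D0 h[of "q i"] h[of "q (Suc i)"] unfolding Suc gS
      by linarith
  qed
  then have "wave_reaches A (l + m) (a k) (4 * d)"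
    using reach[of k] k by (auto intro: wave_reaches_mono)
  moreover have "e \<le> a k" using qlo[of k] h[of "q k"] d unfolding a_def by linarith
  moreover have "a k \<le> e + (4 * int m + 1) * d"
    using qhi'[of k] hd[of k] k unfolding a_def by (simp add: algebra_simps)
  ultimately show ?thesis by blast
qed

section \<open>Holes and their cost at each scale\<close>

definition dist_ahead :: "int set \<Rightarrow> int \<Rightarrow> int" where
  "dist_ahead A p = int (LEAST k. p + int k \<in> A)"

lemma dist_ahead_nonneg: "dist_ahead A p \<ge> 0"
  by (simp add: dist_ahead_def)

lemma dist_ahead_le: "a \<in> A \<Longrightarrow> p \<le> a \<Longrightarrow> dist_ahead A p \<le> a - p"
  unfolding dist_ahead_def using Least_le[of "\<lambda>k. p + int k \<in> A" "nat (a - p)"] by auto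

lemma dist_ahead_mem: "a \<in> A \<Longrightarrow> p \<le> a \<Longrightarrow> p + dist_ahead A p \<in> A"
  unfolding dist_ahead_def using LeastI[of "\<lambda>k. p + int k \<in> A" "nat (a - p)"] by auto

text \<open>
  Adding everything beyond \<open>2 * n\<close> makes \<open>dist_ahead\<close> meaningful everywhere, and it turns the
  end of \<open>A\<close> into an ordinary hole of length at least \<open>n\<close>. A window that reaches this hole is
  expensive at every scale up to \<open>n\<close>, so a cheap window ends before the last point of \<open>A\<close>.
\<close>

definition padded :: "nat \<Rightarrow> int set \<Rightarrow> int set" where
  "padded n A = A \<union> {2 * int n + 1..}"

definition hole_after :: "nat \<Rightarrow> int set \<Rightarrow> int \<Rightarrow> int" where
  "hole_after n A a = dist_ahead (padded n A) (a + 1)"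

text \<open>
  A hole of length \<open>s\<close> adds about \<open>s\<^sup>2 / 2\<close> to the sum of \<open>dist_ahead\<close>. The truncation
  at \<open>4 ^ j\<close> loses nothing, as one hole of that length already makes the scale expensive, and it
  keeps the sum of the contributions of a hole over all scales proportional to its length. The factor \<open>8\<close> has
  two halves: \<open>4 * m * 4 ^ j\<close> bounds the distance travelled at smaller scales, and the same
  length is needed for \<open>m\<close> terms with gaps up to \<open>4 * 4 ^ j\<close>.
\<close>

definition cost :: "nat \<Rightarrow> int set \<Rightarrow> nat \<Rightarrow> nat \<Rightarrow> int \<Rightarrow> int" where
  "cost n A m j p = (\<Sum>a\<in>A \<inter> {p..p + 8 * int m * 4 ^ j}. (min (hole_after n A a) (4 ^ j))\<^sup>2)"

lemma hole_after_nonneg: "hole_after n A a \<ge> 0"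
  by (simp add: hole_after_def dist_ahead_nonneg)

lemma hole_after_less:
  assumes "a \<in> A" "b \<in> A" "a < b"
  shows "a + hole_after n A a < b"
  using dist_ahead_le[of b "padded n A" "a + 1"] assms by (auto simp: hole_after_def padded_def)

lemma sum_hole_after_le:
  assumes A: "A \<subseteq> {1..int n}"
  shows "(\<Sum>a\<in>A. hole_after n A a) \<le> 2 * int n"
proof -
  have fin: "finite A" using A finite_subset by blast
  let ?H = "\<lambda>a. {a + 1..a + hole_after n A a}"
  have "?H a \<inter> ?H b = {}" if "a \<in> A" "b \<in> A" "a \<noteq> b" for a b
    using hole_after_less[of a A b n] hole_after_less[of b A a n] that by (cases "a < b") auto
  then have "card (\<Union>a\<in>A. ?H a) = (\<Sum>a\<in>A. card (?H a))"
    using fin by (intro card_UN_disjoint) auto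
  moreover have "(\<Union>a\<in>A. ?H a) \<subseteq> {1..2 * int n}"
  proof (intro UN_least subsetI)
    fix a x assume a: "a \<in> A" and x: "x \<in> ?H a"
    have "1 \<le> a" "a \<le> int n" using A a by auto
    then have "a + 1 \<le> 2 * int n + 1" by linarith
    then have "hole_after n A a \<le> 2 * int n + 1 - (a + 1)"
      unfolding hole_after_def by (intro dist_ahead_le) (auto simp: padded_def)
    then show "x \<in> {1..2 * int n}" using x \<open>1 \<le> a\<close> by auto
  qed
  then have "card (\<Union>a\<in>A. ?H a) \<le> card {1..2 * int n}" by (intro card_mono) auto
  ultimately have "int (\<Sum>a\<in>A. card (?H a)) \<le> int (card {1..2 * int n})"
    by (simp only: of_nat_le_iff)
  then show ?thesis by (simp add: hole_after_nonneg)
qed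

text \<open>
  A hole of length at least \<open>4 ^ j\<close> would cost \<open>(4 ^ j)\<^sup>2\<close> on its own. So all holes in a cheap
  window are shorter than that, the truncation is inactive, and none of them is the final one. The
  window is covered by the points of \<open>A\<close> in it and the holes after them, and \<open>h \<le> s\<close> on a hole of
  length \<open>s\<close>.
\<close>

lemma cheap_window:
  assumes A: "A \<subseteq> {1..int n}" and p: "p \<in> A" and j: "4 ^ j \<le> n"
    and cheap: "4 * cost n A m j p \<le> (4 ^ j)\<^sup>2"
  defines "h \<equiv> dist_ahead (padded n A)" and "W \<equiv> {p..p + 8 * int m * 4 ^ j}"
  shows "\<And>q. q \<in> W \<Longrightarrow> q + h q \<in> A" and "4 * (\<Sum>q\<in>W. h q) \<le> (4 ^ j)\<^sup>2"
proof -
  have fin: "finite A" using A finite_subset by blast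
  define d :: int where "d = 4 ^ j"
  define s where "s = hole_after n A"
  have d: "d \<ge> 1" "d \<le> int n" using j unfolding d_def by (simp, metis of_nat_le_iff of_nat_numeral of_nat_power)
  have cost: "cost n A m j p = (\<Sum>a\<in>A \<inter> W. (min (s a) d)\<^sup>2)"
    by (simp add: cost_def W_def s_def d_def)
  have short: "s a < d" if a: "a \<in> A \<inter> W" for a
  proof (rule ccontr)
    assume "\<not> s a < d"
    then have "d\<^sup>2 = (min (s a) d)\<^sup>2" by simp
    also have "\<dots> \<le> cost n A m j p"
      unfolding cost using a fin by (intro member_le_sum) auto
    finally have "4 * d\<^sup>2 \<le> d\<^sup>2" using cheap unfolding d_def by linarith
    moreover have "0 < d\<^sup>2" using d by (intro zero_less_power) linarith
    ultimately show False by linarith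
  qed
  have next_in: "a + 1 + s a \<in> A" if a: "a \<in> A \<inter> W" for a
  proof -
    have aA: "a \<le> int n" using a A by auto
    then have "a + 1 + s a \<in> padded n A"
      unfolding s_def hole_after_def
      by (intro dist_ahead_mem[of "2 * int n + 1"]) (auto simp: padded_def)
    then show ?thesis using short[OF a] d aA by (auto simp: padded_def)
  qed
  have pred: "\<exists>a\<in>A \<inter> W. q \<in> {a..a + s a}" if q: "q \<in> W" for q
  proof -
    define a where "a = Max (A \<inter> {..q})"
    have fin': "finite (A \<inter> {..q})" "A \<inter> {..q} \<noteq> {}" using fin p q unfolding W_def by auto
    have a: "a \<in> A" "a \<le> q" using Max_in[OF fin'] unfolding a_def by auto
    have "p \<le> a" unfolding a_def using fin' p q W_def by (intro Max_ge) auto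
    then have aW: "a \<in> A \<inter> W" using a q unfolding W_def by auto
    have "\<not> a + 1 + s a \<le> q"
    proof
      assume "a + 1 + s a \<le> q"
      then have "a + 1 + s a \<le> a"
        unfolding a_def using next_in[OF aW] fin' by (intro Max_ge) (auto simp: a_def)
      then show False using hole_after_nonneg[of n A a] by (simp add: s_def)
    qed
    then show ?thesis using a aW by (intro bexI[of _ a]) auto
  qed
  have hle: "h q \<le> s a" "q + h q \<in> A" if a: "a \<in> A \<inter> W" and q: "q \<in> {a + 1..a + s a}" for a q
  proof -
    have nx: "a + 1 + s a \<in> padded n A" using next_in[OF a] by (simp add: padded_def)
    have "h q \<le> a + 1 + s a - q" unfolding h_def by (intro dist_ahead_le nx) (use q in auto)
    then show "h q \<le> s a" using q by simp
    have "q + h q \<in> padded n A" unfolding h_def by (intro dist_ahead_mem[OF nx]) (use q in auto)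
    moreover have "q + h q \<le> int n"
      using \<open>h q \<le> a + 1 + s a - q\<close> next_in[OF a] A by fastforce
    ultimately show "q + h q \<in> A" by (auto simp: padded_def)
  qed
  have h0: "h a = 0" if "a \<in> A" for a
    using dist_ahead_le[of a "padded n A" a] dist_ahead_nonneg[of "padded n A" a] that
    by (auto simp: h_def padded_def)
  show "q + h q \<in> A" if q: "q \<in> W" for q
  proof -
    obtain a where a: "a \<in> A \<inter> W" "q \<in> {a..a + s a}" using pred[OF q] by blast
    show ?thesis
    proof (cases "q = a")
      case True
      then show ?thesis using a h0 by auto
    next
      case False
      then show ?thesis using a by (intro hle(2)) auto
    qed
  qed
  have disj: "{a..a + s a} \<inter> {b..b + s b} = {}" if "a \<in> A" "b \<in> A" "a \<noteq> b" for a b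
    using hole_after_less[of a A b n] hole_after_less[of b A a n] that
    by (cases "a < b") (auto simp: s_def)
  have "(\<Sum>q\<in>W. h q) \<le> (\<Sum>q\<in>(\<Union>a\<in>A \<inter> W. {a..a + s a}). h q)"
    using fin pred by (intro sum_mono2) (auto simp: h_def dist_ahead_nonneg)
  also have "\<dots> = (\<Sum>a\<in>A \<inter> W. \<Sum>q\<in>{a..a + s a}. h q)"
    using fin disj by (intro sum.UNION_disjoint) auto
  also have "\<dots> \<le> (\<Sum>a\<in>A \<inter> W. (min (s a) d)\<^sup>2)"
  proof (intro sum_mono)
    fix a assume a: "a \<in> A \<inter> W"
    have s0: "s a \<ge> 0" by (simp add: s_def hole_after_nonneg)
    then have "{a..a + s a} = insert a {a + 1..a + s a}" by auto
    then have "(\<Sum>q\<in>{a..a + s a}. h q) = (\<Sum>q\<in>{a + 1..a + s a}. h q)" using h0 a by simp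
    also have "\<dots> \<le> (\<Sum>q\<in>{a + 1..a + s a}. s a)" using a by (intro sum_mono hle(1)) auto
    also have "\<dots> = (min (s a) d)\<^sup>2" using s0 short[OF a] by (simp add: power2_eq_square)
    finally show "(\<Sum>q\<in>{a..a + s a}. h q) \<le> (min (s a) d)\<^sup>2" .
  qed
  finally show "4 * (\<Sum>q\<in>W. h q) \<le> (4 ^ j)\<^sup>2" using cheap cost by simp
qed

section \<open>Choosing the starting point\<close>

text \<open>
  The terms with \<open>4 ^ j \<le> s\<close> are \<open>4 ^ j\<close>, the others \<open>s\<^sup>2 / 4 ^ j\<close>: two geometric series, each
  dominated by its term nearest to \<open>s\<close>. The induction uses the exact value of the first series
  and, for the second, subtracts its tail beyond \<open>J\<close> from the bound.
\<close>

lemma sum_truncated_squares_le: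
  fixes s :: real
  assumes s: "s \<ge> 0"
  shows "(\<Sum>j<J. (min s (4 ^ j))\<^sup>2 / 4 ^ j) \<le> 3 * s"
proof -
  have "(\<Sum>j<J. (min s (4 ^ j))\<^sup>2 / 4 ^ j) \<le>
      (if 4 ^ J \<le> s then 4 ^ J / 3 else 3 * s - 4 / 3 * s\<^sup>2 / 4 ^ J)"
  proof (induction J)
    case 0
    have "s * s \<le> s * 1" if "s < 1" using s that by (intro mult_left_mono) auto
    then have "4 * (s * s) \<le> 9 * s" if "s < 1" using that s by fastforce
    then show ?case by (simp add: power2_eq_square)
  next
    case (Suc J)
    define D :: real where "D = 4 ^ J"
    have D: "D > 0" by (simp add: D_def)
    consider "4 * D \<le> s" | "D \<le> s" "s < 4 * D" | "s < D" by linarith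
    then show ?case
    proof cases
      case 1
      then show ?thesis using Suc D by (simp add: D_def[symmetric] power2_eq_square)
    next
      case 2
      \<comment> \<open>This is the bound \<open>D / 3 + D \<le> 3 * s - s\<^sup>2 / (3 * D)\<close>, multiplied by \<open>3 * D\<close>.\<close>
    have "0 \<le> (s - D) * (4 * D - s) + 4 * D * (s - D) + 4 * D * D"
        using 2 D by (intro add_nonneg_nonneg mult_nonneg_nonneg) auto
      then have "D / 3 + D \<le> 3 * s - 1 / 3 * s\<^sup>2 / D"
        using D by (simp add: field_simps power2_eq_square)
      then show ?thesis using Suc 2 D by (simp add: D_def[symmetric] power2_eq_square)
    next
      case 3
      have "min s D = s" "\<not> D \<le> s" "\<not> 4 * D \<le> s" using 3 D by auto
      then have "(\<Sum>j<Suc J. (min s (4 ^ j))\<^sup>2 / 4 ^ j) \<le> 3 * s - 4 / 3 * s\<^sup>2 / D + s\<^sup>2 / D"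
        using Suc by (simp add: D_def[symmetric])
      also have "\<dots> = 3 * s - 4 / 3 * s\<^sup>2 / (4 * D)" using D by (simp add: field_simps)
      finally show ?thesis using \<open>\<not> 4 * D \<le> s\<close> by (simp add: D_def)
    qed
  qed
  also have "\<dots> \<le> 3 * s" using s by auto
  finally show ?thesis .
qed

text \<open>
  After exchanging the sums, a hole at scale \<open>j\<close> is charged once for each of the at most
  \<open>8 * m * 4 ^ j + 1 \<le> 9 * m * 4 ^ j\<close> points whose window contains its left end. This
  factor cancels one of the two powers of \<open>4 ^ j\<close> in the denominator.
\<close>

lemma sum_cost_le:
  assumes A: "A \<subseteq> {1..int n}" and m: "m \<ge> 1"
  shows "(\<Sum>p\<in>A. \<Sum>j<J. real_of_int (cost n A m j p) / (4 ^ j)\<^sup>2) \<le> 54 * real m * real n"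
proof -
  have fin: "finite A" using A finite_subset by blast
  define f where "f = (\<lambda>j a. (min (real_of_int (hole_after n A a)) (4 ^ j))\<^sup>2)"
  define V :: "nat \<Rightarrow> int" where "V = (\<lambda>j. 8 * int m * 4 ^ j)"
  have f0: "f j a \<ge> 0" for j a by (simp add: f_def)
  have cost: "real_of_int (cost n A m j p) = (\<Sum>a\<in>A. if p \<le> a \<and> a \<le> p + V j then f j a else 0)" for j p
  proof -
    have "real_of_int (cost n A m j p) = (\<Sum>a\<in>A \<inter> {p..p + V j}. f j a)"
      by (simp add: cost_def f_def V_def of_int_min)
    also have "\<dots> = (\<Sum>a\<in>A. if a \<in> {p..p + V j} then f j a else 0)"
      using fin by (rule sum.inter_restrict)
    finally show ?thesis by simp
  qed
  have per_scale: "(\<Sum>p\<in>A. real_of_int (cost n A m j p)) \<le> (\<Sum>a\<in>A. 9 * real m * 4 ^ j * f j a)" for j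
  proof -
    have "(\<Sum>p\<in>A. real_of_int (cost n A m j p)) =
        (\<Sum>a\<in>A. \<Sum>p\<in>A. if p \<le> a \<and> a \<le> p + V j then f j a else 0)"
      unfolding cost by (rule sum.swap)
    also have "\<dots> \<le> (\<Sum>a\<in>A. 9 * real m * 4 ^ j * f j a)"
    proof (intro sum_mono)
      fix a
      have "(\<Sum>p\<in>A. if p \<le> a \<and> a \<le> p + V j then f j a else 0) =
          (\<Sum>p\<in>A. if p \<in> {a - V j..a} then f j a else 0)"
        by (intro sum.cong) auto
      also have "\<dots> = (\<Sum>p\<in>A \<inter> {a - V j..a}. f j a)"
        using fin by (rule sum.inter_restrict[symmetric])
      also have "\<dots> = real (card (A \<inter> {a - V j..a})) * f j a" by simp
      also have "\<dots> \<le> (9 * real m * 4 ^ j) * f j a"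
      proof (intro mult_right_mono f0)
        have "card (A \<inter> {a - V j..a}) \<le> card {a - V j..a}" by (intro card_mono) auto
        also have "card {a - V j..a} = 8 * m * 4 ^ j + 1"
          by (simp add: V_def nat_add_distrib nat_mult_distrib nat_power_eq)
        finally have "real (card (A \<inter> {a - V j..a})) \<le> real (8 * m * 4 ^ j + 1)"
          by (simp only: of_nat_le_iff)
        also have "\<dots> = 8 * real m * 4 ^ j + 1" by simp
        also have "1 \<le> real m * 4 ^ j" using m mult_mono[of 1 "real m" 1 "4 ^ j"] by simp
        finally show "real (card (A \<inter> {a - V j..a})) \<le> 9 * real m * 4 ^ j" by simp
      qed
      finally show "(\<Sum>p\<in>A. if p \<le> a \<and> a \<le> p + V j then f j a else 0) \<le> 9 * real m * 4 ^ j * f j a" .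
    qed
    finally show ?thesis .
  qed
  have "(\<Sum>p\<in>A. \<Sum>j<J. real_of_int (cost n A m j p) / (4 ^ j)\<^sup>2) =
      (\<Sum>j<J. (\<Sum>p\<in>A. real_of_int (cost n A m j p)) / (4 ^ j)\<^sup>2)"
    by (subst sum.swap) (simp add: sum_divide_distrib)
  also have "\<dots> \<le> (\<Sum>j<J. (\<Sum>a\<in>A. 9 * real m * 4 ^ j * f j a) / (4 ^ j)\<^sup>2)"
    by (intro sum_mono divide_right_mono per_scale) simp
  also have "\<dots> = (\<Sum>j<J. \<Sum>a\<in>A. 9 * real m * (f j a / 4 ^ j))"
    by (simp add: sum_divide_distrib power2_eq_square field_simps)
  also have "\<dots> = 9 * real m * (\<Sum>a\<in>A. \<Sum>j<J. f j a / 4 ^ j)"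
    by (subst sum.swap) (simp add: sum_distrib_left)
  also have "\<dots> \<le> 9 * real m * (\<Sum>a\<in>A. 3 * real_of_int (hole_after n A a))"
    unfolding f_def
    by (intro mult_left_mono sum_mono sum_truncated_squares_le) (auto simp: hole_after_nonneg)
  also have "\<dots> = 27 * real m * real_of_int (\<Sum>a\<in>A. hole_after n A a)"
    by (simp add: sum_distrib_left[symmetric])
  also have "\<dots> \<le> 27 * real m * real_of_int (2 * int n)"
    using sum_hole_after_le[OF A] by (intro mult_left_mono, simp only: of_int_le_iff, simp)
  finally show ?thesis by simp
qed

text \<open>
  The average over \<open>A\<close> of the total relative cost is at most \<open>108 * m\<close>, and every expensive
  scale accounts for more than \<open>1 / 4\<close> of it.
\<close>

lemma exists_cheap_start:
  assumes A: "A \<subseteq> {1..int n}" and n: "n \<ge> 1" and dense: "real (card A) \<ge> real n / 2"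
    and m: "m \<ge> 1"
  shows "\<exists>p\<in>A. real (card {j\<in>{..<J}. \<not> 4 * cost n A m j p \<le> (4 ^ j)\<^sup>2}) \<le> 432 * real m"
proof (rule ccontr)
  let ?bad = "\<lambda>p. {j\<in>{..<J}. \<not> 4 * cost n A m j p \<le> (4 ^ j)\<^sup>2}"
  assume "\<not> ?thesis"
  then have many: "432 * real m < real (card (?bad p))" if "p \<in> A" for p using that by force
  have fin: "finite A" using A finite_subset by blast
  have "A \<noteq> {}" using dense n by auto
  have "108 * real m < (\<Sum>j<J. real_of_int (cost n A m j p) / (4 ^ j)\<^sup>2)" if p: "p \<in> A" for p
  proof -
    have "108 * real m < (\<Sum>j\<in>?bad p. 1 / 4 :: real)" using many[OF p] by simp
    also have "\<dots> \<le> (\<Sum>j\<in>?bad p. real_of_int (cost n A m j p) / (4 ^ j)\<^sup>2)"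
    proof (intro sum_mono)
      fix j assume "j \<in> ?bad p"
      then have "(4 ^ j)\<^sup>2 < 4 * cost n A m j p" by simp
      then have "real_of_int ((4 ^ j)\<^sup>2) < real_of_int (4 * cost n A m j p)"
        by (simp only: of_int_less_iff)
      then show "1 / 4 \<le> real_of_int (cost n A m j p) / (4 ^ j)\<^sup>2" by (simp add: field_simps)
    qed
    also have "\<dots> \<le> (\<Sum>j<J. real_of_int (cost n A m j p) / (4 ^ j)\<^sup>2)"
      by (intro sum_mono2) (auto simp: cost_def intro!: divide_nonneg_nonneg sum_nonneg)
    finally show ?thesis .
  qed
  then have "(\<Sum>p\<in>A. 108 * real m) < (\<Sum>p\<in>A. \<Sum>j<J. real_of_int (cost n A m j p) / (4 ^ j)\<^sup>2)"
    using fin \<open>A \<noteq> {}\<close> by (intro sum_strict_mono) auto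
  also have "\<dots> \<le> 54 * real m * real n" by (rule sum_cost_le[OF A m])
  finally have "real m * (108 * real (card A)) < real m * (54 * real n)" by (simp add: algebra_simps)
  then show False using dense by (simp add: mult_less_cancel_left)
qed

section \<open>Gluing the scales\<close>

text \<open>
  At a cheap scale \<open>m\<close> terms are appended, at an expensive one the wave is left as it is. In both
  cases the last gap is small enough for the next scale, and the distance from \<open>p\<close> is at most
  \<open>4 * m * 4 ^ J\<close>: one scale adds at most \<open>(4 * m + 1) * 4 ^ J\<close>, and
  \<open>8 * m + 1 \<le> 16 * m\<close>.
\<close>

lemma wave_through_cheap_scales:
  assumes A: "A \<subseteq> {1..int n}" and p: "p \<in> A" and m: "m \<ge> 1" and J: "4 ^ J \<le> n"
  shows "\<exists>e. wave_reaches A (1 + m * card {j\<in>{..<J}. 4 * cost n A m j p \<le> (4 ^ j)\<^sup>2}) e (4 ^ J) \<and>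
             p \<le> e \<and> e \<le> p + 4 * int m * 4 ^ J"
  using J
proof (induction J)
  case 0
  show ?case using wave_reaches_singleton[OF p] by (intro exI[of _ p]) auto
next
  case (Suc J)
  let ?G = "\<lambda>J. {j\<in>{..<J}. 4 * cost n A m j p \<le> (4 ^ j)\<^sup>2}"
  define d :: int where "d = 4 ^ J"
  have d: "d \<ge> 1" by (simp add: d_def)
  have J: "4 ^ J \<le> n" using Suc.prems by simp
  obtain e where e: "wave_reaches A (1 + m * card (?G J)) e d" "p \<le> e" "e \<le> p + 4 * int m * d"
    using Suc.IH J by (auto simp: d_def)
  show ?case
  proof (cases "4 * cost n A m J p \<le> (4 ^ J)\<^sup>2")
    case True
    let ?h = "dist_ahead (padded n A)"
    have sub: "{e..e + 4 * int m * d} \<subseteq> {p..p + 8 * int m * 4 ^ J}"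
      using e by (auto simp: d_def)
    have "4 * (\<Sum>q\<in>{e..e + 4 * int m * d}. ?h q) \<le> 4 * (\<Sum>q\<in>{p..p + 8 * int m * 4 ^ J}. ?h q)"
      using sub by (intro mult_left_mono sum_mono2) (auto simp: dist_ahead_nonneg)
    then have light: "4 * (\<Sum>q\<in>{e..e + 4 * int m * d}. ?h q) \<le> d\<^sup>2"
      using cheap_window(2)[OF A p J True] by (simp add: d_def)
    obtain e' where e': "wave_reaches A (1 + m * card (?G J) + m) e' (4 * d)" "e \<le> e'"
      "e' \<le> e + (4 * int m + 1) * d"
      using extend_wave[OF dist_ahead_nonneg d m light _ e(1)] cheap_window(1)[OF A p J True] sub
      by blast
    have "?G (Suc J) = insert J (?G J)" using True by (auto simp: less_Suc_eq)
    then have "1 + m * card (?G J) + m = 1 + m * card (?G (Suc J))" by simp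
    moreover have "1 * d \<le> int m * d" using m d by (intro mult_right_mono) auto
    then have "e' \<le> p + 4 * int m * (4 * d)" using e e' by (simp add: algebra_simps)
    ultimately show ?thesis using e e' by (intro exI[of _ e']) (auto simp: d_def)
  next
    case False
    then have "?G (Suc J) = ?G J" by (auto simp: less_Suc_eq)
    moreover have "wave_reaches A (1 + m * card (?G J)) e (4 * d)"
      using e d by (auto intro: wave_reaches_mono)
    moreover have "0 \<le> int m * d" using d by simp
    then have "e \<le> p + 4 * int m * (4 * d)" using e(3) by (simp add: algebra_simps)
    ultimately show ?thesis using e by (intro exI[of _ e]) (auto simp: d_def)
  qed
qed

theorem theorem1p2:
  shows "\<exists>c::real. c > 0 \<and>
    (\<forall>n::nat. n \<ge> 1 \<longrightarrow>
      (\<forall>A::int set. A \<subseteq> {1..int n} \<and> real (card A) \<ge> real n / 2 \<longrightarrow>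
        (\<exists>xs. ascending_wave xs \<and> set xs \<subseteq> A \<and> real (length xs) \<ge> c * (ln (real n))\<^sup>2)))"
proof (intro exI[of _ "1 / 10 ^ 7"] conjI allI impI)
  fix n :: nat and A :: "int set"
  assume n: "n \<ge> 1" and "A \<subseteq> {1..int n} \<and> real (card A) \<ge> real n / 2"
  then have A: "A \<subseteq> {1..int n}" and dense: "real (card A) \<ge> real n / 2" by auto
  obtain J where J: "4 ^ J \<le> n" "n < 4 ^ (J + 1)" using ex_power_ivl1[of 4 n] n by auto
  have "ln (real n) \<le> ln (4 ^ (J + 1))"
  proof -
    have "real n \<le> real (4 ^ (J + 1))" using J(2) by (simp only: of_nat_le_iff)
    then have "real n \<le> 4 ^ (J + 1)" by (simp only: of_nat_power of_nat_numeral)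
    then show ?thesis using n by (subst ln_le_cancel_iff) auto
  qed
  also have "\<dots> = real (J + 1) * ln 4" by (rule ln_realpow)
  also have "\<dots> \<le> real (J + 1) * 2"
    using ln_2_less_1 ln_realpow[of "2::real" 2] by (intro mult_left_mono) auto
  finally have ln_le: "(ln (real n))\<^sup>2 \<le> (2 * (real J + 1))\<^sup>2"
    using n by (intro power_mono) auto
  show "\<exists>xs. ascending_wave xs \<and> set xs \<subseteq> A \<and> real (length xs) \<ge> 1 / 10 ^ 7 * (ln (real n))\<^sup>2"
  \<comment> \<open>The choice \<open>m = J div 864\<close> leaves at most \<open>432 * m \<le> J / 2\<close> expensive scales. If it
    is \<open>0\<close>, then \<open>n\<close> is bounded and a wave with a single term is long enough.\<close>
  proof (cases "J < 864")
    case True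
    have "A \<noteq> {}" using dense n by auto
    then obtain a where "a \<in> A" by blast
    have "(2 * (real J + 1))\<^sup>2 \<le> (2 * 864)\<^sup>2" using True by (intro power_mono) auto
    then have "1 / 10 ^ 7 * (ln (real n))\<^sup>2 \<le> 1" using ln_le by simp
    then show ?thesis using \<open>a \<in> A\<close> by (intro exI[of _ "[a]"]) (auto simp: ascending_wave_def)
  next
    case False
    define m where "m = J div 864"
    have m: "m \<ge> 1" using False by (simp add: m_def div_greater_zero_iff Suc_le_eq)
    have mJ: "864 * m \<le> J" "J < 864 * m + 864" 
      using div_mult_mod_eq[of J 864] mod_less_divisor[of 864 J] unfolding m_def by linarith+
    obtain p where p: "p \<in> A"
      and bad: "real (card {j\<in>{..<J}. \<not> 4 * cost n A m j p \<le> (4 ^ j)\<^sup>2}) \<le> 432 * real m"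
      using exists_cheap_start[OF A n dense m] by blast
    let ?G = "{j\<in>{..<J}. 4 * cost n A m j p \<le> (4 ^ j)\<^sup>2}"
    let ?B = "{j\<in>{..<J}. \<not> 4 * cost n A m j p \<le> (4 ^ j)\<^sup>2}"
    have "card ?G + card ?B = card (?G \<union> ?B)" by (subst card_Un_disjoint) auto
    also have "?G \<union> ?B = {..<J}" by auto
    finally have "card ?G + card ?B = J" by simp
    then have G: "real J / 2 \<le> real (card ?G)" using bad mJ by linarith
    obtain e where "wave_reaches A (1 + m * card ?G) e (4 ^ J)"
      using wave_through_cheap_scales[OF A p m J(1)] by blast
    then obtain xs where xs: "ascending_wave xs" "set xs \<subseteq> A" "length xs = 1 + m * card ?G"
      unfolding wave_reaches_def by blast
    have J1: "real J / 1728 \<le> real m" using mJ m by linarith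
    have "1 / 10 ^ 7 * (ln (real n))\<^sup>2 \<le> 1 / 10 ^ 7 * (4 * real J)\<^sup>2"
    proof -
      have "(2 * (real J + 1))\<^sup>2 \<le> (4 * real J)\<^sup>2" using False by (intro power_mono) auto
      then show ?thesis using ln_le by simp
    qed
    also have "\<dots> \<le> (real J / 1728) * (real J / 2)" by (simp add: power2_eq_square field_simps)
    also have "\<dots> \<le> real m * real (card ?G)" using J1 G by (intro mult_mono) auto
    also have "\<dots> \<le> real (length xs)" using xs(3) by simp
    finally show ?thesis using xs by blast
  qed
qed simp

end
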